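(* Let $\mathcal E_1=(Z_1,\sigma_1,\kappa_1)$ and $\mathcal E_2=(Z_2,\sigma_2,\kappa_2)$ be weighted dual skeletons of degrees $K_1=\deg(\mathcal E_1)$ and $K_2=\deg(\mathcal E_2)$. Then their Cartesian product $\mathcal E_1\times\mathcal E_2$ is again a weighted dual skeleton. Moreover: (1) $\deg(\mathcal E_1\times\mathcal E_2)=K_1K_2$. (2) The orbit ratios of the product satisfy $r_{(z,w)}=r_z\,r_w$ for all $(z,w)\in Z_1\times Z_2$. (3) $\operatorname{logit}C^\ast(\mathcal E_1\times\mathcal E_2)=\operatorname{logit}C^\ast(\mathcal E_1)+\operatorname{logit}C^\ast(\mathcal E_2)$, where $\operatorname{logit}C^\ast=-\tfrac12\log K$ for a skeleton of degree $K$. Equivalently, writing $C_i^\ast=C^\ast(\mathcal E_i)$ and $C^\ast_{12}=C^\ast(\mathcal E_1\times\mathcal E_2)$, $$C^\ast_{12}=\frac{C^\ast_1C^\ast_2}{C^\ast_1C^\ast_2+(1-C^\ast_1)(1-C^\ast_2)}.$$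
   Context: A weighted dual skeleton is a triple $\mathcal E=(Z,\sigma,\kappa)$ where $Z$ is a non-empty finite set, $\sigma:Z\to Z$ satisfies $\sigma^2=\mathrm{id}$, and $\kappa:Z\to\mathbb R_{>0}$ satisfies $\kappa(z)\kappa(\sigma(z))=K$ for all $z\in Z$, with $K>0$ constant; $K=\deg(\mathcal E)$ is the degree. Its universal invariant is $C^\ast(\mathcal E)=1/(1+\sqrt K)$. The orbit ratio at $z$ is $r_z=(\kappa(\sigma(z))/\kappa(z))^{1/2}$. Also $\operatorname{logit}p=\log\frac{p}{1-p}$ for $p\in(0,1)$. The Cartesian product is $\mathcal E_1\times\mathcal E_2=(Z_1\times Z_2,\sigma_1\times\sigma_2,\kappa_1\otimes\kappa_2)$ with $(\sigma_1\times\sigma_2)(z,w)=(\sigma_1(z),\sigma_2(w))$ and $(\kappa_1\otimes\kappa_2)(z,w)=\kappa_1(z)\kappa_2(w)$. *)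

theory Defs
  imports Complex_Main
begin

text \<open>The involution and the weight are total functions; only their values on the underlying
  set matter, and every condition below is relativised to it.\<close>

record 'a skeleton =
  points :: "'a set"
  invol :: "'a \<Rightarrow> 'a"
  weight :: "'a \<Rightarrow> real"

definition weighted_dual_skeleton :: "'a skeleton \<Rightarrow> bool" where
  "weighted_dual_skeleton E \<longleftrightarrow>
     finite (points E) \<and> points E \<noteq> {} \<and>
     (\<forall>z\<in>points E. invol E z \<in> points E) \<and>
     (\<forall>z\<in>points E. invol E (invol E z) = z) \<and>
     (\<forall>z\<in>points E. weight E z > 0) \<and>
     (\<exists>K>0. \<forall>z\<in>points E. weight E z * weight E (invol E z) = K)"

text \<open>The constant \<open>K\<close> is unique because the underlying set is non-empty.\<close>

definition degree :: "'a skeleton \<Rightarrow> real" where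
  "degree E = (THE K. \<forall>z\<in>points E. weight E z * weight E (invol E z) = K)"

definition universal_invariant :: "'a skeleton \<Rightarrow> real" where
  "universal_invariant E = 1 / (1 + sqrt (degree E))"

definition orbit_ratio :: "'a skeleton \<Rightarrow> 'a \<Rightarrow> real" where
  "orbit_ratio E z = sqrt (weight E (invol E z) / weight E z)"

text \<open>Meaningful for \<open>0 < p < 1\<close> only.\<close>

definition logit :: "real \<Rightarrow> real" where
  "logit p = ln (p / (1 - p))"

definition skeleton_prod :: "'a skeleton \<Rightarrow> 'b skeleton \<Rightarrow> ('a \<times> 'b) skeleton" where
  "skeleton_prod E1 E2 =
     \<lparr>points = points E1 \<times> points E2,
      invol = (\<lambda>(z, w). (invol E1 z, invol E2 w)),
      weight = (\<lambda>(z, w). weight E1 z * weight E2 w)\<rparr>"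

lemma degree_eqI:
  assumes "points E \<noteq> {}" and "\<And>z. z \<in> points E \<Longrightarrow> weight E z * weight E (invol E z) = K"
  shows "degree E = K"
  unfolding degree_def using assms by (intro the_equality) auto

lemma weight_mult_weight_invol:
  assumes "weighted_dual_skeleton E" and "z \<in> points E"
  shows "weight E z * weight E (invol E z) = degree E"
  using assms degree_eqI[of E] unfolding weighted_dual_skeleton_def by metis

lemma degree_pos:
  assumes "weighted_dual_skeleton E"
  shows "degree E > 0"
  using assms degree_eqI[of E] unfolding weighted_dual_skeleton_def by metis

lemma universal_invariant_bounds:
  assumes "weighted_dual_skeleton E"
  shows "0 < universal_invariant E" and "universal_invariant E < 1"
  using degree_pos[OF assms] by (auto simp: universal_invariant_def add_pos_pos)

end

theory Submission
  imports Defs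
begin

text \<open>The weight, the involution and hence the product of the weights along an orbit all factor
  over the two coordinates, so the product satisfies the duality condition with constant
  \<open>degree E1 * degree E2\<close>, and the orbit ratios multiply. The invariant depends on the
  skeleton only through its degree: it is the probability whose odds \<open>p / (1 - p)\<close> are
  \<open>1 / sqrt K\<close> (lemma \<open>odds_universal_invariant\<close>). Odds are therefore
  multiplicative under the product; taking logarithms makes the logits additive, and solving for
  the probability itself gives the rational formula, which is the law for combining independent
  odds.\<close>

lemma skeleton_prod_weight_mult_weight_invol:
  assumes "weighted_dual_skeleton E1" "weighted_dual_skeleton E2"
    and "x \<in> points (skeleton_prod E1 E2)"
  shows "weight (skeleton_prod E1 E2) x * weight (skeleton_prod E1 E2) (invol (skeleton_prod E1 E2) x)
    = degree E1 * degree E2"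
proof -
  obtain z w where x: "x = (z, w)" and z: "z \<in> points E1" and w: "w \<in> points E2"
    using assms(3) by (auto simp: skeleton_prod_def)
  have "weight (skeleton_prod E1 E2) x * weight (skeleton_prod E1 E2) (invol (skeleton_prod E1 E2) x)
    = (weight E1 z * weight E1 (invol E1 z)) * (weight E2 w * weight E2 (invol E2 w))"
    by (simp add: x skeleton_prod_def mult_ac)
  then show ?thesis
    using weight_mult_weight_invol[OF assms(1) z] weight_mult_weight_invol[OF assms(2) w] by simp
qed

lemma weighted_dual_skeleton_prod:
  assumes "weighted_dual_skeleton E1" "weighted_dual_skeleton E2"
  shows "weighted_dual_skeleton (skeleton_prod E1 E2)"
proof -
  have "degree E1 * degree E2 > 0"
    using assms by (simp add: degree_pos)
  then have "\<exists>K>0. \<forall>x\<in>points (skeleton_prod E1 E2).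
      weight (skeleton_prod E1 E2) x * weight (skeleton_prod E1 E2) (invol (skeleton_prod E1 E2) x) = K"
    using skeleton_prod_weight_mult_weight_invol[OF assms] by blast
  moreover have "finite (points (skeleton_prod E1 E2))" "points (skeleton_prod E1 E2) \<noteq> {}"
    using assms by (auto simp: weighted_dual_skeleton_def skeleton_prod_def)
  moreover have "\<forall>x\<in>points (skeleton_prod E1 E2).
      invol (skeleton_prod E1 E2) x \<in> points (skeleton_prod E1 E2)
      \<and> invol (skeleton_prod E1 E2) (invol (skeleton_prod E1 E2) x) = x
      \<and> weight (skeleton_prod E1 E2) x > 0"
    using assms by (auto simp: weighted_dual_skeleton_def skeleton_prod_def)
  ultimately show ?thesis
    unfolding weighted_dual_skeleton_def by blast
qed

lemma degree_skeleton_prod: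
  assumes "weighted_dual_skeleton E1" "weighted_dual_skeleton E2"
  shows "degree (skeleton_prod E1 E2) = degree E1 * degree E2"
proof (rule degree_eqI)
  show "points (skeleton_prod E1 E2) \<noteq> {}"
    using weighted_dual_skeleton_prod[OF assms] by (simp add: weighted_dual_skeleton_def)
qed (rule skeleton_prod_weight_mult_weight_invol[OF assms])

lemma orbit_ratio_skeleton_prod:
  "orbit_ratio (skeleton_prod E1 E2) (z, w) = orbit_ratio E1 z * orbit_ratio E2 w"
  by (simp add: orbit_ratio_def skeleton_prod_def flip: real_sqrt_mult)

text \<open>Everything about the invariant is read off from its odds: \<open>C = 1 / (1 + sqrt K)\<close>
  has complement \<open>sqrt K / (1 + sqrt K)\<close>, so the common denominator cancels.\<close>

lemma odds_universal_invariant: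
  assumes "weighted_dual_skeleton E"
  shows "universal_invariant E / (1 - universal_invariant E) = 1 / sqrt (degree E)"
proof -
  have "sqrt (degree E) > 0"
    using degree_pos[OF assms] by simp
  then have "sqrt (degree E) \<noteq> 0" "1 + sqrt (degree E) \<noteq> 0"
    by linarith+
  then show ?thesis
    unfolding universal_invariant_def by (simp add: divide_simps)
qed

lemma logit_universal_invariant:
  assumes "weighted_dual_skeleton E"
  shows "logit (universal_invariant E) = - (1 / 2) * ln (degree E)"
  using degree_pos[OF assms]
  by (simp add: logit_def odds_universal_invariant[OF assms] ln_div ln_sqrt)

text \<open>A probability is determined by its odds, so multiplying odds forces this combination
  law.\<close>

lemma prob_eq_of_odds_mult:
  fixes p q r :: real
  assumes "0 < p" "p < 1" "0 < q" "q < 1" "r < 1"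
    and odds: "r / (1 - r) = p / (1 - p) * (q / (1 - q))"
  shows "r = p * q / (p * q + (1 - p) * (1 - q))"
proof -
  have "p * q + (1 - p) * (1 - q) > 0"
    using assms by (simp add: add_pos_pos)
  moreover have "r * ((1 - p) * (1 - q)) = p * q * (1 - r)"
    using odds assms by (simp add: divide_simps mult_ac)
  then have "r * (p * q + (1 - p) * (1 - q)) = p * q"
    by (simp add: algebra_simps)
  ultimately show ?thesis
    by (simp add: eq_divide_eq)
qed

theorem proposition4p2:
  fixes E1 :: "'a skeleton" and E2 :: "'b skeleton"
  assumes "weighted_dual_skeleton E1" and "weighted_dual_skeleton E2"
  shows "weighted_dual_skeleton (skeleton_prod E1 E2)
    \<and> degree (skeleton_prod E1 E2) = degree E1 * degree E2
    \<and> (\<forall>z\<in>points E1. \<forall>w\<in>points E2.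
           orbit_ratio (skeleton_prod E1 E2) (z, w) = orbit_ratio E1 z * orbit_ratio E2 w)
    \<and> (\<forall>E :: 'c skeleton. weighted_dual_skeleton E \<longrightarrow>
           logit (universal_invariant E) = - (1 / 2) * ln (degree E))
    \<and> logit (universal_invariant (skeleton_prod E1 E2)) =
           logit (universal_invariant E1) + logit (universal_invariant E2)
    \<and> universal_invariant (skeleton_prod E1 E2) =
           universal_invariant E1 * universal_invariant E2 /
           (universal_invariant E1 * universal_invariant E2 +
            (1 - universal_invariant E1) * (1 - universal_invariant E2))"
proof -
  note prod = weighted_dual_skeleton_prod[OF assms]
  note deg = degree_skeleton_prod[OF assms]
  have logit: "logit (universal_invariant (skeleton_prod E1 E2)) =
      logit (universal_invariant E1) + logit (universal_invariant E2)"
    using degree_pos[OF assms(1)] degree_pos[OF assms(2)]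
    by (simp add: logit_universal_invariant[OF prod] logit_universal_invariant[OF assms(1)]
        logit_universal_invariant[OF assms(2)] deg ln_mult field_simps)
  have odds: "universal_invariant (skeleton_prod E1 E2) / (1 - universal_invariant (skeleton_prod E1 E2)) =
      universal_invariant E1 / (1 - universal_invariant E1) *
      (universal_invariant E2 / (1 - universal_invariant E2))"
    by (simp add: odds_universal_invariant[OF prod] odds_universal_invariant[OF assms(1)]
        odds_universal_invariant[OF assms(2)] deg real_sqrt_mult)
  have "universal_invariant (skeleton_prod E1 E2) =
      universal_invariant E1 * universal_invariant E2 /
      (universal_invariant E1 * universal_invariant E2 +
       (1 - universal_invariant E1) * (1 - universal_invariant E2))"
    using universal_invariant_bounds[OF assms(1)] universal_invariant_bounds[OF assms(2)]
      universal_invariant_bounds(2)[OF prod] odds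
    by (rule prob_eq_of_odds_mult)
  then show ?thesis
    using prod deg logit by (auto simp: orbit_ratio_skeleton_prod logit_universal_invariant)
qed

end
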